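(* Let $a,b$ be fixed positive coprime integers and let $g,k$ be integers with $g\ge 1$ and $0\le k<g(a+b)-1$. Then $$|N_k(g)\setminus S_k(g)| = |N_{k+1}(g)|.$$
   Context: All lattice paths take steps in $\{(1,0),(0,1)\}$. The points of a path starting at $(x,y)$ are the lattice points visited, including its startpoint and endpoint. The boundary of a path is the line segment joining its startpoint to its endpoint. A flaw of a path is a point of the path lying strictly above its boundary. $N(g)$ is the set of all such paths from $(0,0)$ to $(ga,gb)$. $N_k(g)\subseteq N(g)$ is the set of those with exactly $k$ flaws; the possible values are $0\le k<g(a+b)$. A path in $N(g)$ has max flaws if it has $g(a+b)-1$ flaws. For paths $p_1,p_2$, the concatenation $p_1p_2$ starts at the startpoint of $p_1$, takes the steps of $p_1$ in order and then the steps of $p_2$ in order. For $0\le k<g(a+b)-1$, $S_k(g)$ is the set of paths in $N_k(g)$ of the form $p_1p_2$, where for some $j$ with $0<j<g$ we have $p_1\in N_0(g-j)$ and $p_2\in N_k(j)$, and $p_2$ has max flaws (that is, $k=j(a+b)-1$). *)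

theory Defs
  imports "HOL-Analysis.Analysis"
begin

type_synonym point = "int \<times> int"

datatype step = East | North

primrec step_vec :: "step \<Rightarrow> point" where
  "step_vec East = (1, 0)"
| "step_vec North = (0, 1)"

datatype path = Path (startpoint: point) (steps: "step list")

definition point_after :: "path \<Rightarrow> nat \<Rightarrow> point" where
  "point_after p i = startpoint p + sum_list (map step_vec (take i (steps p)))"

definition points :: "path \<Rightarrow> point set" where
  "points p = {point_after p i | i. i \<le> length (steps p)}"

definition endpoint :: "path \<Rightarrow> point" where
  "endpoint p = point_after p (length (steps p))"

definition real_point :: "point \<Rightarrow> real \<times> real" where
  "real_point q = (real_of_int (fst q), real_of_int (snd q))"

definition boundary :: "path \<Rightarrow> (real \<times> real) set" where
  "boundary p = closed_segment (real_point (startpoint p)) (real_point (endpoint p))"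

text \<open>The universal clause matters only for vertical segments, where a point of the segment is
  not to count as lying above it.\<close>

definition strictly_above :: "real \<times> real \<Rightarrow> (real \<times> real) set \<Rightarrow> bool" where
  "strictly_above q B \<longleftrightarrow>
     (\<exists>y. (fst q, y) \<in> B) \<and> (\<forall>y. (fst q, y) \<in> B \<longrightarrow> y < snd q)"

definition flaws :: "path \<Rightarrow> point set" where
  "flaws p = {q \<in> points p. strictly_above (real_point q) (boundary p)}"

definition concat_path :: "path \<Rightarrow> path \<Rightarrow> path" where
  "concat_path p1 p2 = Path (startpoint p1) (steps p1 @ steps p2)"

definition N :: "nat \<Rightarrow> nat \<Rightarrow> nat \<Rightarrow> path set" where
  "N a b g = {p. startpoint p = (0, 0) \<and> endpoint p = (int (g * a), int (g * b))}"

definition N_flaws :: "nat \<Rightarrow> nat \<Rightarrow> nat \<Rightarrow> nat \<Rightarrow> path set" where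
  "N_flaws a b k g = {p \<in> N a b g. card (flaws p) = k}"

definition has_max_flaws :: "nat \<Rightarrow> nat \<Rightarrow> nat \<Rightarrow> path \<Rightarrow> bool" where
  "has_max_flaws a b g p \<longleftrightarrow> p \<in> N a b g \<and> card (flaws p) = g * (a + b) - 1"

definition S :: "nat \<Rightarrow> nat \<Rightarrow> nat \<Rightarrow> nat \<Rightarrow> path set" where
  "S a b k g = {p \<in> N_flaws a b k g. \<exists>j p1 p2. 0 < j \<and> j < g \<and>
     p1 \<in> N_flaws a b 0 (g - j) \<and> p2 \<in> N_flaws a b k j \<and> has_max_flaws a b j p2 \<and>
     p = concat_path p1 p2}"

text \<open>The sets being counted are finite, so \<^const>\<open>card\<close> is the genuine cardinality.\<close>

lemma finite_points: "finite (points p)"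
  unfolding points_def by simp

lemma sum_step_vec: "fst (sum_list (map step_vec xs)) + snd (sum_list (map step_vec xs)) = int (length xs)"
proof (induction xs)
  case (Cons s xs)
  then show ?case by (cases s) auto
qed simp

lemma finite_N: "finite (N a b g)"
proof (rule finite_subset)
  have "finite {xs :: step list. set xs \<subseteq> {East, North} \<and> length xs = g * a + g * b}"
    by (rule finite_lists_length_eq) simp
  then show "finite (Path (0, 0) ` {xs. set xs \<subseteq> {East, North} \<and> length xs = g * a + g * b})"
    by (rule finite_imageI)
  show "N a b g \<subseteq> Path (0, 0) ` {xs. set xs \<subseteq> {East, North} \<and> length xs = g * a + g * b}"
  proof
    fix p assume p: "p \<in> N a b g"
    obtain s xs where [simp]: "p = Path s xs" by (cases p)
    have s: "s = (0, 0)" and e: "sum_list (map step_vec xs) = (int (g * a), int (g * b))"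
      using p by (auto simp: N_def endpoint_def point_after_def prod_eq_iff)
    have "int (length xs) = int (g * a + g * b)"
      using sum_step_vec[of xs] unfolding e by simp
    then have "length xs = g * a + g * b" by linarith
    moreover have "set xs \<subseteq> {East, North}" using step.exhaust by blast
    ultimately show "p \<in> Path (0, 0) ` {xs. set xs \<subseteq> {East, North} \<and> length xs = g * a + g * b}"
      using s by auto
  qed
qed

end

theory Submission
  imports Defs
begin

text \<open>Give a north step weight \<open>a\<close> and an east step weight \<open>- b\<close>, so that the flaws of a path are its
  positive partial sums. By the Sparre Andersen rearrangement, the paths with \<open>k\<close> positive partial
  sums are as many as those whose partial sums attain their maximum first at index \<open>k\<close>. Moving the
  first step to the end turns a first maximum at index \<open>k + 1\<close> into one at index \<open>k\<close>, and a first
  maximum at index \<open>k\<close> fails to arise in this way exactly when, before the move, the path first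
  returns to the boundary at index \<open>k + 1\<close> from strictly below and never rises above it
  afterwards. Reversing the part before that return and moving it to the end gives the paths
  in \<open>S\<^sub>k(g)\<close>.\<close>

section \<open>Positive partial sums and first maxima\<close>

definition height :: "('a \<Rightarrow> 'b::linordered_ab_group_add) \<Rightarrow> 'a list \<Rightarrow> 'b" where
  "height f xs = sum_list (map f xs)"

lemma height_simps [simp]:
  "height f [] = 0"
  "height f (x # xs) = f x + height f xs"
  "height f (xs @ ys) = height f xs + height f ys"
  by (simp_all add: height_def)

lemma height_rev [simp]: "height f (rev xs) = height f xs"
  by (induction xs) (simp_all add: add.commute)

lemma height_mset: "mset xs = mset ys \<Longrightarrow> height f xs = height f ys"
  unfolding height_def by (metis mset_map sum_mset_sum_list)

lemma height_drop: "height f (drop n xs) = height f xs - height f (take n xs)"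
  by (metis append_take_drop_id add_diff_cancel_left' height_simps(3))

lemma height_take_rev: "height f (take i (rev xs)) = height f xs - height f (take (length xs - i) xs)"
  by (simp add: take_rev height_drop)

text \<open>Indices are counted rather than heights, so a height attained several times counts
  several times; for lattice paths each index is a separate point.\<close>

definition pos_count :: "('a \<Rightarrow> 'b::linordered_ab_group_add) \<Rightarrow> 'a list \<Rightarrow> nat" where
  "pos_count f xs = card {i. i \<le> length xs \<and> 0 < height f (take i xs)}"

lemma pos_count_Nil [simp]: "pos_count f [] = 0"
  by (simp add: pos_count_def)

lemma pos_count_snoc:
  "pos_count f (xs @ [c]) = pos_count f xs + (if 0 < height f (xs @ [c]) then 1 else 0)"
proof -
  have "{i. i \<le> length (xs @ [c]) \<and> 0 < height f (take i (xs @ [c]))} =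
      {i. i \<le> length xs \<and> 0 < height f (take i xs)} \<union>
      (if 0 < height f (xs @ [c]) then {Suc (length xs)} else {})"
    by (auto simp: le_Suc_eq)
  then show ?thesis
    by (auto simp: pos_count_def card_insert_if)
qed

text \<open>Since \<open>xs\<close> ends at height 0, the partial sums of \<open>ys\<close> are the
  same after \<open>xs\<close> as on their own.\<close>

lemma pos_count_append:
  assumes "height f xs = 0"
  shows "pos_count f (xs @ ys) = pos_count f xs + pos_count f ys"
proof (induction ys rule: rev_induct)
  case (snoc c ys)
  then show ?case
    using assms pos_count_snoc[of f "xs @ ys" c] pos_count_snoc[of f ys c] by simp
qed simp

lemma pos_count_eq_0_iff:
  "pos_count f xs = 0 \<longleftrightarrow> (\<forall>i\<le>length xs. height f (take i xs) \<le> 0)"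
  by (auto simp: pos_count_def not_less)

text \<open>Both end indices have height 0, so \<open>length xs - 1\<close> is the largest possible
  count, and reaching it forces every interior index to be positive. This is the word form of having
  max flaws.\<close>

lemma pos_count_eq_length_iff:
  assumes "height f xs = 0" "xs \<noteq> []"
  shows "pos_count f xs = length xs - 1 \<longleftrightarrow> (\<forall>i. 0 < i \<and> i < length xs \<longrightarrow> 0 < height f (take i xs))"
proof -
  let ?P = "{i. i \<le> length xs \<and> 0 < height f (take i xs)}"
  have sub: "?P \<subseteq> {1..<length xs}"
  proof
    fix i assume i: "i \<in> ?P"
    have "i \<noteq> 0" using i by (intro notI) simp
    moreover have "i \<noteq> length xs" using i assms(1) by (intro notI) simp
    ultimately show "i \<in> {1..<length xs}" using i by auto
  qed
  have "pos_count f xs = length xs - 1 \<longleftrightarrow> ?P = {1..<length xs}"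
    using card_subset_eq[OF _ sub] by (auto simp: pos_count_def)
  also have "\<dots> \<longleftrightarrow> {1..<length xs} \<subseteq> ?P"
    using sub by blast
  also have "\<dots> \<longleftrightarrow> (\<forall>i. 0 < i \<and> i < length xs \<longrightarrow> 0 < height f (take i xs))"
    by (auto simp: subset_iff Suc_le_eq)
  finally show ?thesis .
qed

section \<open>First maxima and the Sparre Andersen rearrangement\<close>

definition first_max :: "('a \<Rightarrow> 'b::linordered_ab_group_add) \<Rightarrow> 'a list \<Rightarrow> nat \<Rightarrow> bool" where
  "first_max f xs k \<longleftrightarrow> k \<le> length xs \<and>
     (\<forall>i<k. height f (take i xs) < height f (take k xs)) \<and>
     (\<forall>i\<le>length xs. height f (take i xs) \<le> height f (take k xs))"

lemma first_max_unique:
  assumes "first_max f xs k" "first_max f xs l"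
  shows "k = l"
proof (rule ccontr)
  assume "k \<noteq> l"
  then consider "k < l" | "l < k" by linarith
  then show False
    using assms by cases (auto simp: first_max_def dest: leD)
qed

text \<open>The maximum is at least 0, the height at index 0. The new last index has height at most
  0, so at best it ties and comes later.\<close>

lemma first_max_snoc:
  assumes "first_max f xs k" "height f (xs @ [c]) \<le> 0"
  shows "first_max f (xs @ [c]) k"
proof -
  have "0 \<le> height f (take k xs)"
    using assms(1) unfolding first_max_def by (metis height_simps(1) le0 take0)
  then show ?thesis
    using assms by (auto simp: first_max_def le_Suc_eq)
qed

text \<open>Prepending shifts every index by one and every height by \<open>f c\<close>. The only
  new competitor is index 0 at height 0, and it loses strictly because the maximum is at least the
  total, which is positive.\<close>

lemma first_max_Cons:
  assumes "first_max f xs k" "0 < height f (c # xs)"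
  shows "first_max f (c # xs) (Suc k)"
proof -
  have "height f xs \<le> height f (take k xs)"
    using assms(1) by (auto simp: first_max_def)
  then have "0 < f c + height f (take k xs)"
    using assms(2) by (metis add_left_mono height_simps(2) order_less_le_trans)
  then show ?thesis
    using assms(1) by (auto simp: first_max_def less_Suc_eq_0_disj take_Cons' less_imp_le)
qed

text \<open>The Sparre Andersen rearrangement, acting on the reversed word.\<close>

fun rearrange :: "('a \<Rightarrow> 'b::linordered_ab_group_add) \<Rightarrow> 'a list \<Rightarrow> 'a list" where
  "rearrange f [] = []"
| "rearrange f (c # v) = (if height f (c # v) \<le> 0 then rearrange f v @ [c] else c # rearrange f v)"

lemma mset_rearrange [simp]: "mset (rearrange f v) = mset v"
  by (induction v) auto

lemma height_rearrange [simp]: "height f (rearrange f v) = height f v"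
  by (rule height_mset) simp

lemma length_rearrange [simp]: "length (rearrange f v) = length v"
  by (metis mset_rearrange size_mset)

text \<open>The head \<open>c\<close> is the last letter of the reversed word, so the sign of the
  total decides whether its index is counted. The same test in \<open>rearrange\<close> decides
  whether the first maximum stays or moves up by one.\<close>

lemma first_max_rearrange: "first_max f (rearrange f v) (pos_count f (rev v))"
proof (induction v)
  case Nil
  then show ?case by (simp add: first_max_def)
next
  case (Cons c v)
  have h: "height f (rev v @ [c]) = height f (c # v)" by (simp add: add.commute)
  show ?case
  proof (cases "height f (c # v) \<le> 0")
    case True
    then have "first_max f (rearrange f v @ [c]) (pos_count f (rev v))"
      by (intro first_max_snoc Cons.IH) (simp add: add.commute)
    then show ?thesis using True h by (simp add: pos_count_snoc add.commute flip: not_le)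
  next
    case False
    then have "first_max f (c # rearrange f v) (Suc (pos_count f (rev v)))"
      by (intro first_max_Cons Cons.IH) simp
    then show ?thesis using False h by (auto simp: pos_count_snoc add.commute not_le dest: leD)
  qed
qed

text \<open>The total is invariant under \<open>rearrange\<close>, so the image reveals which branch
  was taken and hence at which end to remove the letter.\<close>

lemma rearrange_inject: "rearrange f u = rearrange f v \<Longrightarrow> u = v"
proof (induction u arbitrary: v)
  case Nil
  then show ?case by (metis length_0_conv length_rearrange)
next
  case (Cons c u)
  have "length v = Suc (length u)" by (metis Cons.prems length_Cons length_rearrange)
  then obtain d v' where v: "v = d # v'" by (cases v) auto
  have "height f (c # u) = height f v" by (metis Cons.prems height_rearrange)
  then show ?case
    using Cons by (auto simp: v split: if_splits)
qed

text \<open>Closure under permutation makes the rearrangement a self-map of the finite set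
  \<open>A\<close>; being injective it is onto, which spares an explicit inverse.\<close>

lemma card_pos_count_eq_card_first_max:
  assumes "finite A" and closed: "\<And>xs ys. xs \<in> A \<Longrightarrow> mset ys = mset xs \<Longrightarrow> ys \<in> A"
  shows "card {xs \<in> A. pos_count f xs = k} = card {xs \<in> A. first_max f xs k}"
proof -
  \<comment> \<open>Reversing first makes the count in \<open>first_max_rearrange\<close> that of
    \<open>xs\<close> itself.\<close>
  define r where "r xs = rearrange f (rev xs)" for xs
  have inj: "inj_on r A" by (auto simp: r_def intro!: inj_onI dest: rearrange_inject)
  have onto: "r ` A = A"
    using assms(1) inj by (intro endo_inj_surj) (auto simp: r_def intro: closed)
  have iff: "first_max f (r xs) k \<longleftrightarrow> pos_count f xs = k" for xs
    unfolding r_def using first_max_rearrange[of f "rev xs"] first_max_unique by fastforce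
  have "{xs \<in> A. first_max f xs k} = {xs \<in> r ` A. first_max f xs k}"
    by (simp only: onto)
  also have "\<dots> = r ` {xs \<in> A. pos_count f xs = k}"
    using iff by blast
  finally have "{xs \<in> A. first_max f xs k} = r ` {xs \<in> A. pos_count f xs = k}" .
  moreover have "inj_on r {xs \<in> A. pos_count f xs = k}"
    using inj by (rule inj_on_subset) blast
  ultimately show ?thesis by (simp add: card_image)
qed

section \<open>Rotation by one step and first returns from below\<close>

definition first_return_from_below ::
    "('a \<Rightarrow> 'b::linordered_ab_group_add) \<Rightarrow> 'a list \<Rightarrow> nat \<Rightarrow> bool" where
  "first_return_from_below f xs m \<longleftrightarrow> height f (take m xs) = 0 \<and>
     (\<forall>i. 0 < i \<and> i < m \<longrightarrow> height f (take i xs) < 0) \<and>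
     (\<forall>i\<le>length xs. height f (take i xs) \<le> 0)"

text \<open>Rotation shifts all heights by the same constant and removes index 0 from the
  competition, so \<open>Suc k\<close> need only be the first maximum among the positive indices.
  This maximum is at least 0, since the last index has height 0. If it is positive, it also beats
  index 0; if it is 0, it ties with index 0, and that case is
  \<open>first_return_from_below\<close>.\<close>

lemma first_max_rotate1_iff:
  assumes "height f xs = 0" "k < length xs"
  shows "first_max f (rotate1 xs) k \<longleftrightarrow>
    first_max f xs (Suc k) \<or> first_return_from_below f xs (Suc k)"
proof -
  obtain c ys where xs: "xs = c # ys" using assms(2) by (cases xs) auto
  let ?h = "\<lambda>i. height f (take i xs)"
  have r: "height f (take i (rotate1 xs)) = ?h (Suc i) - f c" if "i < length xs" for i
    using that by (simp add: xs)
  \<comment> \<open>As the total is 0, the last index of the rotated word repeats the height of its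
    index 0 and adds no new condition.\<close>
  have rl: "height f (take (length xs) (rotate1 xs)) = ?h 1 - f c"
    using assms(1) by (simp add: xs add.commute)
  have L: "?h (length xs) = 0" using assms(1) by simp
  have "first_max f (rotate1 xs) k \<longleftrightarrow>
      (\<forall>i<k. ?h (Suc i) < ?h (Suc k)) \<and> (\<forall>i<length xs. ?h (Suc i) \<le> ?h (Suc k))"
    (is "_ = (?A \<and> ?B)")
  proof -
    have "(\<forall>i\<le>length xs. height f (take i (rotate1 xs)) \<le> ?h (Suc k) - f c) \<longleftrightarrow> ?B"
    proof
      assume *: "\<forall>i\<le>length xs. height f (take i (rotate1 xs)) \<le> ?h (Suc k) - f c"
      show ?B
      proof (intro allI impI)
        fix i assume "i < length xs"
        with * r[of i] show "?h (Suc i) \<le> ?h (Suc k)"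
          by (metis diff_add_cancel add_right_mono less_imp_le)
      qed
    next
      assume B: ?B
      have "0 < length xs" using assms(2) by linarith
      show "\<forall>i\<le>length xs. height f (take i (rotate1 xs)) \<le> ?h (Suc k) - f c"
      proof (intro allI impI)
        fix i assume "i \<le> length xs"
        then consider "i < length xs" | "i = length xs" by linarith
        then show "height f (take i (rotate1 xs)) \<le> ?h (Suc k) - f c"
        proof cases
          case 1
          then show ?thesis unfolding r[OF 1] using B diff_right_mono by blast
        next
          case 2
          have "?h 1 \<le> ?h (Suc k)" using B \<open>0 < length xs\<close> by (metis One_nat_def)
          then show ?thesis unfolding 2 rl by (rule diff_right_mono)
        qed
      qed
    qed
    moreover have "(\<forall>i<k. height f (take i (rotate1 xs)) < ?h (Suc k) - f c) \<longleftrightarrow> ?A"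
      using assms(2) r by simp
    ultimately show ?thesis
      using assms(2) unfolding first_max_def by (simp add: r del: take_Suc_Cons)
  qed
  \<comment> \<open>The comparison with index 0, absent from \<open>?A\<close> and
    \<open>?B\<close>, contributes the strict inequality.\<close>
  moreover have "first_max f xs (Suc k) \<longleftrightarrow> 0 < ?h (Suc k) \<and> ?A \<and> ?B"
  proof -
    have "(\<forall>i<Suc k. ?h i < ?h (Suc k)) \<longleftrightarrow> 0 < ?h (Suc k) \<and> ?A"
      by (subst All_less_Suc2) simp
    moreover have "(\<forall>i<Suc (length xs). ?h i \<le> ?h (Suc k)) \<longleftrightarrow> 0 \<le> ?h (Suc k) \<and> ?B"
      by (subst All_less_Suc2) simp
    ultimately show ?thesis
      using assms(2) by (auto simp: first_max_def less_Suc_eq_le less_imp_le)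
  qed
  moreover have "first_return_from_below f xs (Suc k) \<longleftrightarrow> 0 = ?h (Suc k) \<and> ?A \<and> ?B"
  proof -
    have "(\<forall>i. 0 < i \<and> i < Suc k \<longrightarrow> ?h i < 0) \<longleftrightarrow> (\<forall>i<k. ?h (Suc i) < 0)"
      using All_less_Suc2[of k "\<lambda>i. 0 < i \<longrightarrow> ?h i < 0"] by auto
    moreover have "(\<forall>i<Suc (length xs). ?h i \<le> 0) \<longleftrightarrow> (\<forall>i<length xs. ?h (Suc i) \<le> 0)"
      by (subst All_less_Suc2) simp
    ultimately show ?thesis
      unfolding first_return_from_below_def less_Suc_eq_le by metis
  qed
  moreover have "0 \<le> ?h (Suc k)" if ?B
    using that[rule_format, of "length xs - 1"] L assms(2) by simp
  ultimately show ?thesis by (auto simp: order.order_iff_strict)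
qed

text \<open>Index 0 separates the two cases: a first maximum lies strictly above it, a return ties
  with it.\<close>

lemma first_max_Suc_not_first_return:
  "first_max f xs (Suc k) \<Longrightarrow> \<not> first_return_from_below f xs (Suc k)"
  unfolding first_max_def first_return_from_below_def
  by (metis height_simps(1) less_irrefl take0 zero_less_Suc)

section \<open>Lattice paths as words\<close>

text \<open>The resulting \<open>height\<close> is the cross product of \<open>(a, b)\<close> with
  the point reached, so its sign tells the side of the boundary.\<close>

primrec slope_weight :: "nat \<Rightarrow> nat \<Rightarrow> step \<Rightarrow> int" where
  "slope_weight a b East = - int b"
| "slope_weight a b North = int a"

definition words :: "nat \<Rightarrow> nat \<Rightarrow> nat \<Rightarrow> step list set" where
  "words a b g = {xs. count_list xs East = g * a \<and> count_list xs North = g * b}"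

lemma sum_list_step_vec:
  "sum_list (map step_vec xs) = (int (count_list xs East), int (count_list xs North))"
proof (induction xs)
  case (Cons s xs)
  then show ?case by (cases s) auto
qed (simp add: zero_prod_def)

lemma length_eq_count: "length xs = count_list xs East + count_list xs North"
proof (induction xs)
  case (Cons s xs)
  then show ?case by (cases s) auto
qed simp

lemma height_slope_weight:
  "height (slope_weight a b) xs = int a * int (count_list xs North) - int b * int (count_list xs East)"
proof (induction xs)
  case (Cons s xs)
  then show ?case by (cases s) (auto simp: algebra_simps)
qed simp

lemma length_words: "xs \<in> words a b g \<Longrightarrow> length xs = g * (a + b)"
  by (simp add: words_def length_eq_count algebra_simps)

lemma height_words [simp]: "xs \<in> words a b g \<Longrightarrow> height (slope_weight a b) xs = 0"
  by (simp add: words_def height_slope_weight)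

lemma words_mset: "xs \<in> words a b g \<Longrightarrow> mset ys = mset xs \<Longrightarrow> ys \<in> words a b g"
  by (simp add: words_def flip: count_mset)

lemma words_append: "xs \<in> words a b i \<Longrightarrow> ys \<in> words a b j \<Longrightarrow> xs @ ys \<in> words a b (i + j)"
  by (simp add: words_def algebra_simps)

lemma words_appendD:
  assumes "xs @ ys \<in> words a b g" "xs \<in> words a b j" "j \<le> g"
  shows "ys \<in> words a b (g - j)"
  using assms by (auto simp: words_def diff_mult_distrib)

text \<open>The only use of coprimality: the boundary meets the lattice in the multiples of \<open>(a, b)\<close>.\<close>

lemma height_0_imp_words:
  assumes "a > 0" "coprime a b" "height (slope_weight a b) xs = 0"
  obtains j where "xs \<in> words a b j"
proof -
  have "int (a * count_list xs North) = int (b * count_list xs East)"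
    using assms(3) by (simp add: height_slope_weight)
  then have eq: "a * count_list xs North = b * count_list xs East" by linarith
  then have "a dvd b * count_list xs East" by (metis dvd_triv_left)
  then have "a dvd count_list xs East"
    using assms(2) coprime_dvd_mult_right_iff by blast
  then obtain j where j: "count_list xs East = a * j" ..
  then have "count_list xs North = b * j" using eq assms(1) by simp
  with j have "xs \<in> words a b j" by (simp add: words_def mult.commute)
  then show ?thesis by (rule that)
qed

lemma N_eq_words: "N a b g = Path (0, 0) ` words a b g"
proof -
  have "p \<in> N a b g \<longleftrightarrow> p \<in> Path (0, 0) ` words a b g" for p
  proof (cases p)
    case (Path s xs)
    have "p \<in> N a b g \<longleftrightarrow> s = (0, 0) \<and> sum_list (map step_vec xs) = (int (g * a), int (g * b))"
      by (auto simp: N_def endpoint_def point_after_def Path prod_eq_iff)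
    also have "\<dots> \<longleftrightarrow> s = (0, 0) \<and> xs \<in> words a b g"
      unfolding sum_list_step_vec words_def prod.inject of_nat_eq_iff by simp
    finally show ?thesis by (auto simp: Path)
  qed
  then show ?thesis by blast
qed

lemma inj_Path: "inj_on (Path s) A"
  by (auto intro: inj_onI)

lemma finite_words: "finite (words a b g)"
  using finite_N[of a b g] unfolding N_eq_words by (rule finite_imageD) (rule inj_Path)

section \<open>Flaws as positive partial sums\<close>

lemma strictly_above_segment_iff:
  fixes x y c d :: real
  assumes "0 < c" "0 \<le> x" "x \<le> c"
  shows "strictly_above (x, y) (closed_segment (0, 0) (c, d)) \<longleftrightarrow> d * x < c * y"
proof -
  \<comment> \<open>As \<open>0 < c\<close>, the segment is not vertical and has exactly one point
    over \<open>x\<close>; both clauses of \<open>strictly_above\<close> then become one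
    comparison.\<close>
  have "(x, z) \<in> closed_segment (0, 0) (c, d) \<longleftrightarrow> z = d * x / c" for z
  proof
    assume "(x, z) \<in> closed_segment (0, 0) (c, d)"
    then obtain u where "x = u * c" "z = u * d" by (auto simp: closed_segment_def)
    then show "z = d * x / c" using assms(1) by simp
  next
    assume "z = d * x / c"
    then show "(x, z) \<in> closed_segment (0, 0) (c, d)"
      using assms by (auto simp: closed_segment_def intro!: exI[of _ "x / c"])
  qed
  then show ?thesis
    using assms(1) by (simp add: strictly_above_def pos_divide_less_eq mult.commute)
qed

lemma card_flaws:
  assumes "a > 0" "g > 0" "xs \<in> words a b g"
  shows "card (flaws (Path (0, 0) xs)) = pos_count (slope_weight a b) xs"
proof -
  let ?p = "Path (0, 0) xs"
  let ?I = "{i. i \<le> length xs \<and> 0 < height (slope_weight a b) (take i xs)}"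
  have pt: "point_after ?p i = (int (count_list (take i xs) East), int (count_list (take i xs) North))" for i
    by (simp add: point_after_def sum_list_step_vec)
  have ep: "endpoint ?p = (int (g * a), int (g * b))"
    using assms(3) unfolding endpoint_def pt by (simp add: words_def)
  have above: "strictly_above (real_point (point_after ?p i)) (boundary ?p) \<longleftrightarrow>
      0 < height (slope_weight a b) (take i xs)" for i
  proof -
    let ?x = "count_list (take i xs) East" and ?y = "count_list (take i xs) North"
    \<comment> \<open>This places the point within the horizontal range of the boundary.\<close>
    have "?x + count_list (drop i xs) East = g * a"
      using assms(3) unfolding words_def by (metis (mono_tags) append_take_drop_id count_list_append mem_Collect_eq)
    then have x: "real ?x \<le> real (g * a)" unfolding of_nat_le_iff by linarith
    have c: "0 < real (g * a)" using assms by simp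
    have "strictly_above (real_point (point_after ?p i)) (boundary ?p) \<longleftrightarrow>
        real (g * b) * real ?x < real (g * a) * real ?y"
      using strictly_above_segment_iff[OF c _ x, of "real ?y" "real (g * b)"]
      by (simp add: boundary_def ep pt real_point_def)
    also have "\<dots> \<longleftrightarrow> g * (b * ?x) < g * (a * ?y)"
      unfolding of_nat_mult[symmetric] of_nat_less_iff by (simp add: mult.assoc)
    also have "\<dots> \<longleftrightarrow> int (b * ?x) < int (a * ?y)"
      using assms(2) unfolding of_nat_less_iff by simp
    finally show ?thesis by (simp add: height_slope_weight)
  qed
  have "flaws ?p = point_after ?p ` ?I"
    using above by (auto simp: flaws_def points_def)
  \<comment> \<open>The coordinate sum of a visited point is its index, so no point is visited
    twice.\<close>
  moreover have "inj_on (point_after ?p) ?I"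
  proof (rule inj_onI)
    fix i j assume "i \<in> ?I" "j \<in> ?I" "point_after ?p i = point_after ?p j"
    then have "length (take i xs) = length (take j xs)"
      unfolding length_eq_count pt by simp
    then show "i = j" using \<open>i \<in> ?I\<close> \<open>j \<in> ?I\<close> by simp
  qed
  ultimately show ?thesis by (simp add: card_image pos_count_def)
qed

lemma N_flaws_eq_words:
  assumes "a > 0" "g > 0"
  shows "N_flaws a b k g = Path (0, 0) ` {xs \<in> words a b g. pos_count (slope_weight a b) xs = k}"
  unfolding N_flaws_def N_eq_words using card_flaws[OF assms] by auto

section \<open>The set \<open>S\<close> and first returns from below\<close>

lemma S_eq_words:
  assumes "a > 0"
  shows "S a b k g = Path (0, 0) ` {xs @ ys | xs ys j. 0 < j \<and> j < g \<and> k + 1 = j * (a + b) \<and>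
    xs \<in> words a b (g - j) \<and> pos_count (slope_weight a b) xs = 0 \<and>
    ys \<in> words a b j \<and> pos_count (slope_weight a b) ys = k}" (is "_ = Path (0, 0) ` ?T")
proof
  show "S a b k g \<subseteq> Path (0, 0) ` ?T"
  proof
    fix p assume "p \<in> S a b k g"
    then obtain j p1 p2 where j: "0 < j" "j < g"
      and p1: "p1 \<in> N_flaws a b 0 (g - j)" and p2: "p2 \<in> N_flaws a b k j"
      and max: "has_max_flaws a b j p2" and p: "p = concat_path p1 p2"
      by (auto simp: S_def)
    have "k = j * (a + b) - 1" using p2 max by (simp add: N_flaws_def has_max_flaws_def)
    \<comment> \<open>Positivity guards against truncated subtraction when passing to
      \<open>k + 1\<close>.\<close>
    moreover have "0 < j * (a + b)" using j assms by simp
    ultimately have k: "k + 1 = j * (a + b)" by linarith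
    have "g - j > 0" using j by simp
    from p1 obtain xs where xs: "p1 = Path (0, 0) xs" "xs \<in> words a b (g - j)"
      "pos_count (slope_weight a b) xs = 0"
      unfolding N_flaws_eq_words[OF assms \<open>g - j > 0\<close>] by blast
    from p2 obtain ys where ys: "p2 = Path (0, 0) ys" "ys \<in> words a b j"
      "pos_count (slope_weight a b) ys = k"
      unfolding N_flaws_eq_words[OF assms j(1)] by blast
    have "p = Path (0, 0) (xs @ ys)" by (simp add: p xs(1) ys(1) concat_path_def)
    then show "p \<in> Path (0, 0) ` ?T" using j k xs(2,3) ys(2,3) by blast
  qed
next
  show "Path (0, 0) ` ?T \<subseteq> S a b k g"
  proof
    fix p assume "p \<in> Path (0, 0) ` ?T"
    then obtain xs ys j where p: "p = Path (0, 0) (xs @ ys)" and j: "0 < j" "j < g"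
      and k: "k + 1 = j * (a + b)"
      and xs: "xs \<in> words a b (g - j)" "pos_count (slope_weight a b) xs = 0"
      and ys: "ys \<in> words a b j" "pos_count (slope_weight a b) ys = k"
      by blast
    have pos: "g > 0" "g - j > 0" using j by auto
    have "xs @ ys \<in> words a b g" using words_append[OF xs(1) ys(1)] j by simp
    \<comment> \<open>The boundaries of both pieces and of the whole path lie on one line, so the
      flaw counts add up to 0 + \<open>k\<close>.\<close>
    moreover have "pos_count (slope_weight a b) (xs @ ys) = k"
      using xs ys by (simp add: pos_count_append)
    ultimately have "p \<in> N_flaws a b k g" unfolding p N_flaws_eq_words[OF assms pos(1)] by blast
    moreover have "Path (0, 0) xs \<in> N_flaws a b 0 (g - j)"
      unfolding N_flaws_eq_words[OF assms pos(2)] using xs by blast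
    moreover have "Path (0, 0) ys \<in> N_flaws a b k j"
      unfolding N_flaws_eq_words[OF assms j(1)] using ys by blast
    moreover from this have "has_max_flaws a b j (Path (0, 0) ys)"
      using k by (simp add: N_flaws_def has_max_flaws_def flip: k)
    moreover have "p = concat_path (Path (0, 0) xs) (Path (0, 0) ys)"
      by (simp add: p concat_path_def)
    ultimately show "p \<in> S a b k g" using j by (auto simp: S_def)
  qed
qed

text \<open>Reversing a word of total 0 negates its heights and swaps index \<open>i\<close> with
  \<open>length us - i\<close>. Max flaws of \<open>us\<close> thus become a stay strictly below 0
  until the return, and never rising afterwards says that \<open>xs\<close> has no flaws.\<close>

lemma first_return_rev_append_iff:
  assumes "height f us = 0" "us \<noteq> []"
  shows "first_return_from_below f (rev us @ xs) (length us) \<longleftrightarrow>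
    pos_count f us = length us - 1 \<and> pos_count f xs = 0"
proof -
  let ?m = "length us"
  have us: "height f (take i (rev us)) = - height f (take (?m - i) us)" for i
    using assms(1) by (simp add: height_take_rev)
  have "(\<forall>i. 0 < i \<and> i < ?m \<longrightarrow> height f (take i (rev us @ xs)) < 0) \<longleftrightarrow>
      (\<forall>i. 0 < i \<and> i < ?m \<longrightarrow> 0 < height f (take (?m - i) us))"
    by (auto simp: us)
  also have "\<dots> \<longleftrightarrow> (\<forall>i. 0 < i \<and> i < ?m \<longrightarrow> 0 < height f (take i us))"
  proof (intro iffI allI impI; elim conjE)
    fix i assume *: "\<forall>i. 0 < i \<and> i < ?m \<longrightarrow> 0 < height f (take (?m - i) us)" and "0 < i" "i < ?m"
    then show "0 < height f (take i us)" using *[rule_format, of "?m - i"] by simp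
  qed simp
  also have "\<dots> \<longleftrightarrow> pos_count f us = ?m - 1"
    using pos_count_eq_length_iff[OF assms] by simp
  finally have A: "(\<forall>i. 0 < i \<and> i < ?m \<longrightarrow> height f (take i (rev us @ xs)) < 0) \<longleftrightarrow>
      pos_count f us = ?m - 1" .
  \<comment> \<open>The assumption takes care of the indices inside \<open>rev us\<close>; those
    beyond it see only the heights of \<open>xs\<close>.\<close>
  have B: "(\<forall>i\<le>length (rev us @ xs). height f (take i (rev us @ xs)) \<le> 0) \<longleftrightarrow> pos_count f xs = 0"
    if "\<forall>i. 0 < i \<and> i < ?m \<longrightarrow> height f (take i (rev us @ xs)) < 0"
    unfolding pos_count_eq_0_iff
  proof (intro iffI allI impI)
    fix i assume *: "\<forall>i\<le>length (rev us @ xs). height f (take i (rev us @ xs)) \<le> 0"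
      and i: "i \<le> length xs"
    show "height f (take i xs) \<le> 0"
      using *[rule_format, of "?m + i"] i assms(1) by simp
  next
    fix i assume *: "\<forall>i\<le>length xs. height f (take i xs) \<le> 0" and i: "i \<le> length (rev us @ xs)"
    consider "i = 0" | "0 < i" "i < ?m" | "?m \<le> i" by linarith
    then show "height f (take i (rev us @ xs)) \<le> 0"
    proof cases
      case 2
      then show ?thesis using that by (simp add: less_imp_le)
    next
      case 3
      then show ?thesis using *[rule_format, of "i - ?m"] i assms(1) by simp
    qed simp
  qed
  have "height f (take ?m (rev us @ xs)) = 0" using assms(1) by simp
  then show ?thesis
    unfolding first_return_from_below_def using A B by blast
qed

text \<open>Cutting at the return and moving the reversed initial piece to the end is a bijection.
  It is injective because the cut is always at \<open>k + 1\<close> and all words involved have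
  equal length.\<close>

lemma card_S:
  assumes "a > 0" "coprime a b" "k + 1 < g * (a + b)"
  shows "card (S a b k g) =
    card {ws \<in> words a b g. first_return_from_below (slope_weight a b) ws (k + 1)}"
    (is "_ = card ?D")
proof -
  let ?f = "slope_weight a b"
  let ?r = "\<lambda>ws :: step list. drop (k + 1) ws @ rev (take (k + 1) ws)"
  let ?T = "{xs @ ys | xs ys j. 0 < j \<and> j < g \<and> k + 1 = j * (a + b) \<and>
    xs \<in> words a b (g - j) \<and> pos_count ?f xs = 0 \<and> ys \<in> words a b j \<and> pos_count ?f ys = k}"
  have "inj_on ?r ?D"
  proof (rule inj_onI)
    fix v w assume v: "v \<in> ?D" and w: "w \<in> ?D" and eq: "?r v = ?r w"
    have "length v = length w" using v w length_words by fastforce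
    then have "drop (k + 1) v = drop (k + 1) w \<and> take (k + 1) v = take (k + 1) w"
      using eq by simp
    then show "v = w" by (metis append_take_drop_id)
  qed
  moreover have "?r ` ?D = ?T"
  proof (intro subset_antisym subsetI)
    fix z assume "z \<in> ?r ` ?D"
    then obtain w where z: "z = ?r w" and w: "w \<in> words a b g"
      and ret: "first_return_from_below ?f w (k + 1)" by blast
    define us where "us = rev (take (k + 1) w)"
    define xs where "xs = drop (k + 1) w"
    have len: "length us = k + 1" using length_words[OF w] assms(3) by (simp add: us_def)
    have w_eq: "w = rev us @ xs" by (simp add: us_def xs_def)
    have h: "height ?f us = 0" using ret by (simp add: us_def first_return_from_below_def)
    \<comment> \<open>The return point is a lattice point on the boundary, hence \<open>j\<close>
      times \<open>(a, b)\<close>; this is the \<open>j\<close> of the decomposition.\<close>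
    obtain j where j: "us \<in> words a b j" using height_0_imp_words[OF assms(1,2) h] .
    have k: "k + 1 = j * (a + b)" using length_words[OF j] len by simp
    have "0 < j" using k by (cases j) auto
    have "j < g"
    proof (rule ccontr)
      \<comment> \<open>Otherwise the return would come no earlier than the end of the path, against
        the bound on \<open>k\<close>.\<close>
      assume "\<not> j < g"
      then have "g * (a + b) \<le> j * (a + b)" by (intro mult_right_mono) auto
      then show False using assms(3) k by linarith
    qed
    have "rev us \<in> words a b j" using words_mset[OF j] by simp
    then have xs: "xs \<in> words a b (g - j)"
      using words_appendD[of "rev us" xs] w w_eq \<open>j < g\<close> by simp
    have "pos_count ?f us = k \<and> pos_count ?f xs = 0"
      using first_return_rev_append_iff[OF h, of xs] ret w_eq len by force
    then show "z \<in> ?T"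
      using z j k xs \<open>0 < j\<close> \<open>j < g\<close> unfolding us_def xs_def by blast
  next
    fix z assume "z \<in> ?T"
    then obtain xs us j where z: "z = xs @ us" and j: "0 < j" "j < g"
      and k: "k + 1 = j * (a + b)"
      and xs: "xs \<in> words a b (g - j)" "pos_count ?f xs = 0"
      and us: "us \<in> words a b j" "pos_count ?f us = k"
      by blast
    have len: "length us = k + 1" using length_words[OF us(1)] k by simp
    have "rev us \<in> words a b j" using words_mset[OF us(1)] by simp
    from words_append[OF this xs(1)] have "rev us @ xs \<in> words a b g" using j by simp
    moreover have "first_return_from_below ?f (rev us @ xs) (k + 1)"
      using first_return_rev_append_iff[of ?f us xs] us xs len by force
    moreover have "z = ?r (rev us @ xs)" using len by (simp add: z)
    ultimately show "z \<in> ?r ` ?D" by blast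
  qed
  ultimately have "card ?T = card ?D" using card_image by fastforce
  then show ?thesis
    unfolding S_eq_words[OF assms(1)] card_image[OF inj_Path] .
qed

section \<open>The final count by rotation\<close>

lemma card_N_flaws:
  assumes "a > 0" "g > 0"
  shows "card (N_flaws a b k g) = card {xs \<in> words a b g. first_max (slope_weight a b) xs k}"
  unfolding N_flaws_eq_words[OF assms] card_image[OF inj_Path]
  using finite_words words_mset by (rule card_pos_count_eq_card_first_max)

theorem theorem1p5:
  fixes a b g k :: nat
  assumes "a > 0" and "b > 0" and "coprime a b"
    and "g \<ge> 1" and "k < g * (a + b) - 1"
  shows "card (N_flaws a b k g - S a b k g) = card (N_flaws a b (k + 1) g)"
proof -
  let ?f = "slope_weight a b"
  let ?W = "words a b g"
  let ?F = "\<lambda>k. {xs \<in> ?W. first_max ?f xs k}"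
  let ?D = "{xs \<in> ?W. first_return_from_below ?f xs (k + 1)}"
  have g: "g > 0" and k: "k + 1 < g * (a + b)" using assms(4,5) by linarith+
  have rot: "rotate1 xs \<in> ?F k \<longleftrightarrow> xs \<in> ?F (k + 1) \<union> ?D" for xs
  proof -
    have "rotate1 xs \<in> ?W \<longleftrightarrow> xs \<in> ?W"
      using words_mset[of xs a b g "rotate1 xs"] words_mset[of "rotate1 xs" a b g xs]
      by (cases xs) auto
    moreover have "first_max ?f (rotate1 xs) k \<longleftrightarrow>
        first_max ?f xs (k + 1) \<or> first_return_from_below ?f xs (k + 1)" if "xs \<in> ?W"
      using first_max_rotate1_iff[of ?f xs k] that k by (simp add: length_words)
    ultimately show ?thesis by blast
  qed
  \<comment> \<open>\<open>rotate1\<close> is a bijection on all lists, so \<open>?F k\<close> has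
    as many elements as its preimage, which splits into the words with first maximum at
    \<open>k + 1\<close> and those counted by \<open>card_S\<close>.\<close>
  have "?F k \<subseteq> range rotate1" by (simp add: surj_rotate1)
  then have "card (?F k) = card (rotate1 -` ?F k)" by (rule card_vimage_inj[OF inj_rotate1, symmetric])
  also have "rotate1 -` ?F k = ?F (k + 1) \<union> ?D" using rot by blast
  also have "card (?F (k + 1) \<union> ?D) = card (?F (k + 1)) + card ?D"
    by (rule card_Un_disjoint)
      (auto intro: finite_subset[OF _ finite_words] dest: first_max_Suc_not_first_return)
  finally have "card (N_flaws a b k g) = card (N_flaws a b (k + 1) g) + card (S a b k g)"
    unfolding card_N_flaws[OF assms(1) g] card_S[OF assms(1,3) k] .
  moreover have "S a b k g \<subseteq> N_flaws a b k g" by (auto simp: S_def)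
  moreover have "finite (N_flaws a b k g)"
    using finite_N by (rule finite_subset[rotated]) (auto simp: N_flaws_def)
  ultimately show ?thesis by (simp add: card_Diff_subset finite_subset)
qed

end
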